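(* Let $\delta>0$, let $L\ge 2$ be an integer, let $G_+^{(L)},G_-^{(L)}>0$ be real, and define $$G_\pm^{(L-1)}=G_\pm^{(L)}+\frac{1}{2\delta L}\,G_+^{(L)}G_-^{(L)}.$$ Write $\eta^{(\ell)}=\tfrac12\big(G_+^{(\ell)}-G_-^{(\ell)}\big)$ and $\alpha^{(\ell)}=\tfrac12\ln\big(G_+^{(\ell)}/G_-^{(\ell)}\big)$ for $\ell\in\{L,L-1\}$. Then $\eta^{(L-1)}=\eta^{(L)}$, so $\eta$ is invariant under the map $(G_+^{(L)},G_-^{(L)})\mapsto(G_+^{(L-1)},G_-^{(L-1)})$, whereas $\alpha$ is not an invariant of this map (the equality $\alpha^{(L-1)}=\alpha^{(L)}$ does not hold for all choices of couplings). In particular each of the critical lines $G_+-G_-=2\delta$ and $G_+-G_-=-2\delta$ is mapped into itself.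
   Context: The map $(G_+^{(L)},G_-^{(L)})\mapsto(G_+^{(L-1)},G_-^{(L-1)})$ is the renormalisation group map for the pairing couplings of a BCS model with $L$ equally spaced levels of spacing $\delta$ (with $\delta$ kept fixed), obtained by eliminating one extremal level. The critical lines are the subsets of the coupling space $\{(G_+,G_-):G_+,G_->0\}$ given by $G_+-G_-=\pm2\delta$. *)

theory Defs
  imports Complex_Main
begin

(* Couplings are pairs (G_+, G_-). *)

definition coupling_space :: "(real \<times> real) set" where
  "coupling_space = {(Gp, Gm). Gp > 0 \<and> Gm > 0}"

(* One step from L to L - 1 levels; delta is the level spacing. *)
definition rg_map :: "real \<Rightarrow> nat \<Rightarrow> real \<times> real \<Rightarrow> real \<times> real" where
  "rg_map \<delta> L = (\<lambda>(Gp, Gm).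
     (Gp + 1 / (2 * \<delta> * real L) * (Gp * Gm),
      Gm + 1 / (2 * \<delta> * real L) * (Gp * Gm)))"

definition eta :: "real \<times> real \<Rightarrow> real" where
  "eta = (\<lambda>(Gp, Gm). (Gp - Gm) / 2)"

definition alpha :: "real \<times> real \<Rightarrow> real" where
  "alpha = (\<lambda>(Gp, Gm). ln (Gp / Gm) / 2)"

definition critical_line_plus :: "real \<Rightarrow> (real \<times> real) set" where
  "critical_line_plus \<delta> = {(Gp, Gm) \<in> coupling_space. Gp - Gm = 2 * \<delta>}"

definition critical_line_minus :: "real \<Rightarrow> (real \<times> real) set" where
  "critical_line_minus \<delta> = {(Gp, Gm) \<in> coupling_space. Gp - Gm = - 2 * \<delta>}"

end

theory Submission
  imports Defs
begin

text \<open>The map adds one common increment c, a multiple of the product of the couplings, to both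
  of them. The difference, hence \<open>eta\<close>, is unchanged, while for c > 0 the ratio changes
  unless the couplings are equal (\<open>alpha_rg_map_neq\<close>). The critical lines are level
  sets of \<open>eta\<close> in the positive quadrant, which the map preserves
  (\<open>rg_map_in_coupling_space\<close>).\<close>

lemma eta_rg_map: "eta (rg_map \<delta> L G) = eta G"
  by (cases G) (simp add: eta_def rg_map_def)

lemma rg_map_in_coupling_space:
  assumes "\<delta> > 0" and "G \<in> coupling_space"
  shows "rg_map \<delta> L G \<in> coupling_space"
  \<comment> \<open>The increment is only nonnegative here: for \<open>L = 0\<close> it vanishes,
    since division by zero gives 0.\<close>
  using assms by (cases G) (auto simp: coupling_space_def rg_map_def intro!: add_pos_nonneg)

text \<open>Reduces invariance of the line to that of \<open>eta\<close> and of positivity.\<close>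

lemma critical_line_plus_eta: "critical_line_plus \<delta> = {G \<in> coupling_space. eta G = \<delta>}"
  by (auto simp: critical_line_plus_def eta_def)

lemma critical_line_minus_eta: "critical_line_minus \<delta> = {G \<in> coupling_space. eta G = - \<delta>}"
  by (auto simp: critical_line_minus_def eta_def)

text \<open>Adding the same c > 0 to numerator and denominator moves a positive ratio other than 1
  towards 1, and \<open>ln\<close> is injective on positive reals.\<close>

lemma alpha_rg_map_neq:
  assumes "\<delta> > 0" and "L > 0" and "(Gp, Gm) \<in> coupling_space" and "Gp \<noteq> Gm"
  shows "alpha (rg_map \<delta> L (Gp, Gm)) \<noteq> alpha (Gp, Gm)"
proof
  define c where "c = 1 / (2 * \<delta> * real L) * (Gp * Gm)"
  have pos: "Gp > 0" "Gm > 0" using assms(3) by (auto simp: coupling_space_def)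
  then have c: "c > 0" using assms(1,2) by (simp add: c_def)
  assume "alpha (rg_map \<delta> L (Gp, Gm)) = alpha (Gp, Gm)"
  then have "ln ((Gp + c) / (Gm + c)) = ln (Gp / Gm)"
    by (simp add: alpha_def rg_map_def c_def)
  then have "(Gp + c) / (Gm + c) = Gp / Gm"
    using pos c by (subst (asm) ln_inj_iff) auto
  then have "(Gp + c) * Gm = Gp * (Gm + c)"
    using pos c by (simp add: frac_eq_eq)
  \<comment> \<open>The common term \<open>Gp * Gm\<close> cancels.\<close>
  then have "c * (Gp - Gm) = 0" by (auto simp: algebra_simps)
  then show False using c assms(4) by simp
qed

theorem mainTheorem3:
  fixes \<delta> :: real and L :: nat
  assumes "\<delta> > 0" and "L \<ge> 2"
  shows "(\<forall>G \<in> coupling_space. eta (rg_map \<delta> L G) = eta G) \<and>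
         \<not> (\<forall>G \<in> coupling_space. alpha (rg_map \<delta> L G) = alpha G) \<and>
         rg_map \<delta> L ` critical_line_plus \<delta> \<subseteq> critical_line_plus \<delta> \<and>
         rg_map \<delta> L ` critical_line_minus \<delta> \<subseteq> critical_line_minus \<delta>"
proof (intro conjI)
  \<comment> \<open>Any pair of unequal positive couplings would refute invariance of
    \<open>alpha\<close>; this one works for all \<delta> and \<open>L\<close> at once.\<close>
  have "(2, 1) \<in> coupling_space" by (simp add: coupling_space_def)
  moreover from this have "alpha (rg_map \<delta> L (2, 1)) \<noteq> alpha (2, 1)"
    using assms by (intro alpha_rg_map_neq) auto
  ultimately show "\<not> (\<forall>G \<in> coupling_space. alpha (rg_map \<delta> L G) = alpha G)" by blast
qed (use assms(1) in \<open>auto simp: eta_rg_map critical_line_plus_eta critical_line_minus_eta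
       rg_map_in_coupling_space\<close>)

end
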